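(* There is an absolute constant $c<26$ such that for every integer $n\ge 1$, all $\alpha,\beta\in[-\infty,0]$ and all $f,g,h\in C_0(\mathbb{R}^n)$, $$\|f\|_1\,\|f\star_\alpha g\star_\alpha h\|_1\le c^n\,\|f\star_\beta g\|_1\,\|f\star_\beta h\|_1 .$$
   Context: For $\alpha\in[-\infty,0]$, a function $f:\mathbb{R}^n\to[0,\infty)$ is $\alpha$-concave if for all $x,y$ with $f(x),f(y)>0$ and all $\lambda\in[0,1]$, $f(\lambda x+(1-\lambda)y)\ge[\lambda f(x)^\alpha+(1-\lambda)f(y)^\alpha]^{1/\alpha}$, where the right side is read as $f(x)^\lambda f(y)^{1-\lambda}$ for $\alpha=0$ and as $\min\{f(x),f(y)\}$ for $\alpha=-\infty$. $C_\alpha(\mathbb{R}^n)$ is the set of upper semicontinuous $\alpha$-concave $f:\mathbb{R}^n\to[0,\infty)$ with $\|f\|_\infty=f(0)=1$ and $\lim_{|x|\to\infty}f(x)=0$. In particular $C_0(\mathbb{R}^n)$ consists of log-concave functions, and $C_0(\mathbb{R}^n)\subset C_\alpha(\mathbb{R}^n)$ for $\alpha\le 0$. The $\alpha$-sum is $(f\star_\alpha g)(x)=\sup_{y+z=x}(f(y)^\alpha+g(z)^\alpha-1)^{1/\alpha}$ for $-\infty<\alpha<0$ (the expression is $0$ whenever $f(y)=0$ or $g(z)=0$), $(f\star_0 g)(x)=\sup_{y+z=x}f(y)g(z)$, and $(f\star_{-\infty}g)(x)=\sup_{y+z=x}\min\{f(y),g(z)\}$. The operation is associative and commutative. $\|f\|_1=\int_{\mathbb{R}^n}f(x)\,dx$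 for $f\ge 0$. *)

theory Defs
  imports "HOL-Analysis.Analysis"
begin

text \<open>
  The dimension \<open>n\<close> is a term, not a type, because one constant has to serve all dimensions.
  \<open>\<real>\<^sup>n\<close> is the set of extensional functions on \<open>{..<n}\<close>, which is both the carrier of the
  product topology \<open>powertop_real {..<n}\<close> and the space of the product measure
  \<open>\<Pi>\<^sub>M i\<in>{..<n}. lborel\<close>. Values of functions outside of this set are irrelevant throughout.
\<close>

definition rspace :: "nat \<Rightarrow> (nat \<Rightarrow> real) set" where
  "rspace n = {..<n} \<rightarrow>\<^sub>E UNIV"

definition vzero :: "nat \<Rightarrow> nat \<Rightarrow> real" where
  "vzero n = (\<lambda>i\<in>{..<n}. 0)"

definition vadd :: "nat \<Rightarrow> (nat \<Rightarrow> real) \<Rightarrow> (nat \<Rightarrow> real) \<Rightarrow> nat \<Rightarrow> real" where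
  "vadd n x y = (\<lambda>i\<in>{..<n}. x i + y i)"

definition vscale :: "nat \<Rightarrow> real \<Rightarrow> (nat \<Rightarrow> real) \<Rightarrow> nat \<Rightarrow> real" where
  "vscale n c x = (\<lambda>i\<in>{..<n}. c * x i)"

definition vnorm :: "nat \<Rightarrow> (nat \<Rightarrow> real) \<Rightarrow> real" where
  "vnorm n x = L2_set x {..<n}"

definition upper_semicontinuous :: "nat \<Rightarrow> ((nat \<Rightarrow> real) \<Rightarrow> real) \<Rightarrow> bool" where
  "upper_semicontinuous n f \<longleftrightarrow>
     (\<forall>t. openin (powertop_real {..<n}) {x \<in> rspace n. f x < t})"

definition vanishes_at_infinity :: "nat \<Rightarrow> ((nat \<Rightarrow> real) \<Rightarrow> real) \<Rightarrow> bool" where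
  "vanishes_at_infinity n f \<longleftrightarrow>
     (f \<longlongrightarrow> 0) (inf (filtercomap (vnorm n) at_top) (principal (rspace n)))"

definition alpha_mean :: "ereal \<Rightarrow> real \<Rightarrow> real \<Rightarrow> real \<Rightarrow> real" where
  "alpha_mean \<alpha> l a b =
     (if \<alpha> = -\<infinity> then min a b
      else if \<alpha> = 0 then a powr l * b powr (1 - l)
      else (l * a powr real_of_ereal \<alpha> + (1 - l) * b powr real_of_ereal \<alpha>)
             powr (1 / real_of_ereal \<alpha>))"

definition alpha_concave :: "nat \<Rightarrow> ereal \<Rightarrow> ((nat \<Rightarrow> real) \<Rightarrow> real) \<Rightarrow> bool" where
  "alpha_concave n \<alpha> f \<longleftrightarrow>
     (\<forall>x\<in>rspace n. 0 \<le> f x) \<and>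
     (\<forall>x\<in>rspace n. \<forall>y\<in>rspace n. \<forall>l\<in>{0..1}. f x > 0 \<longrightarrow> f y > 0 \<longrightarrow>
        f (vadd n (vscale n l x) (vscale n (1 - l) y)) \<ge> alpha_mean \<alpha> l (f x) (f y))"

text \<open>The supremum norm is taken in \<^typ>\<open>ereal\<close>, so that it is meaningful for unbounded functions.\<close>

definition Cclass :: "nat \<Rightarrow> ereal \<Rightarrow> ((nat \<Rightarrow> real) \<Rightarrow> real) set" where
  "Cclass n \<alpha> = {f. upper_semicontinuous n f \<and> alpha_concave n \<alpha> f \<and>
     (SUP x\<in>rspace n. ereal \<bar>f x\<bar>) = 1 \<and> f (vzero n) = 1 \<and> vanishes_at_infinity n f}"

text \<open>
  For \<open>a = 0\<close> or \<open>b = 0\<close> the separate case is needed: \<open>a powr r = 0\<close> in HOL even for negative \<open>r\<close>,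
  whereas here \<open>a\<close> to the power \<open>r\<close> should be read as \<open>\<infinity>\<close>.
\<close>

definition alpha_comb :: "ereal \<Rightarrow> real \<Rightarrow> real \<Rightarrow> real" where
  "alpha_comb \<alpha> a b =
     (if \<alpha> = -\<infinity> then min a b
      else if \<alpha> = 0 then a * b
      else if a = 0 \<or> b = 0 then 0
      else (a powr real_of_ereal \<alpha> + b powr real_of_ereal \<alpha> - 1) powr (1 / real_of_ereal \<alpha>))"

text \<open>
  For functions with values in \<open>[0,1]\<close>, such as the elements of \<open>Cclass n \<alpha>\<close> and their
  \<open>\<alpha>\<close>-sums, the set below is non-empty and contained in \<open>[0,1]\<close>, so that \<^const>\<open>Sup\<close> on the
  reals is the true supremum.
\<close>

definition alpha_sum ::
  "nat \<Rightarrow> ereal \<Rightarrow> ((nat \<Rightarrow> real) \<Rightarrow> real) \<Rightarrow> ((nat \<Rightarrow> real) \<Rightarrow> real) \<Rightarrow> (nat \<Rightarrow> real) \<Rightarrow> real" where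
  "alpha_sum n \<alpha> f g x =
     Sup {alpha_comb \<alpha> (f y) (g z) | y z. y \<in> rspace n \<and> z \<in> rspace n \<and> vadd n y z = x}"

definition L1norm :: "nat \<Rightarrow> ((nat \<Rightarrow> real) \<Rightarrow> real) \<Rightarrow> ennreal" where
  "L1norm n f = (\<integral>\<^sup>+ x. ennreal \<bar>f x\<bar> \<partial>(\<Pi>\<^sub>M i\<in>{..<n}. lborel))"

end

theory Submission
  imports Defs
begin

text \<open>
  The constant is \<open>12\<close>. For values in \<open>[0,1]\<close> all the operations
  \<^const>\<open>alpha_comb\<close> lie between the product and the minimum (\<open>alpha_comb_bounds\<close>). So the two sums
  on the right-hand side may be replaced by \<open>F = f \<star>\<^sub>0 g\<close> and \<open>H = f \<star>\<^sub>0 h\<close>, and of the triple sum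
  \<open>S\<close> on the left only the following is used: if \<open>t < S d\<close>, then \<open>d = a + b + c\<close> where \<open>f a\<close>, \<open>g b\<close>
  and \<open>h c\<close> exceed \<open>t\<close>.

  The idea is to split \<open>d/3\<close> together with a second parameter \<open>x\<^sub>0\<close>, distributed over two copies of
  \<open>f\<close>, into one argument of \<open>F\<close> and one of \<open>H\<close>. For any \<open>w\<close> put
  \<open>u = w/2 + a/6 + b/3\<close> and \<open>v = (x\<^sub>0 - w)/2 + a/6 + c/3\<close>, so that \<open>u + v = x\<^sub>0/2 + d/3\<close>. Since \<open>f\<close>
  and \<open>g\<close> are log-concave with value \<open>1\<close> at the origin, \<open>f (w/2 + a/6) \<ge> f(w)\<^bsup>1/2\<^esup> t\<^bsup>1/6\<^esup>\<close> and
  \<open>g (b/3) \<ge> t\<^bsup>1/3\<^esup>\<close>, hence \<open>F u \<ge> (f(w) t)\<^bsup>1/2\<^esup>\<close> (\<open>zero_sum_lower_bound\<close>). Likewise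
  \<open>H v \<ge> (f(x\<^sub>0 - w) t)\<^bsup>1/2\<^esup>\<close>. The product of these bounds is integrated over \<open>w\<close>, where \<open>a, b, c\<close>
  are constant (\<open>overlap_bound\<close>), and then over \<open>d\<close>. By Tonelli and the two changes of scale, with
  \<open>K x\<^sub>0 = \<integral> (f(w) f(x\<^sub>0 - w))\<^bsup>1/2\<^esup> dw\<close>,
    \<open>\<parallel>S\<parallel> * K x\<^sub>0 \<le> 6\<^sup>n * \<parallel>F\<parallel> * \<parallel>H\<parallel>\<close> for every \<open>x\<^sub>0\<close> (\<open>L1norm_alpha_sum_overlap\<close>).

  That \<open>K\<close> is not small on average follows from log-concavity once more: the product
  \<open>f(w) f(x\<^sub>0 - w)\<close> is at most \<open>f(x\<^sub>0/2)\<close> times its square root, so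
  \<open>\<parallel>f\<parallel>\<^sup>2 \<le> \<integral> f(x\<^sub>0/2) K(x\<^sub>0) dx\<^sub>0\<close> (\<open>L1norm_square_le\<close>). As \<open>\<integral> f(x\<^sub>0/2) dx\<^sub>0 = 2\<^sup>n \<parallel>f\<parallel>\<close>, combining the two
  estimates gives \<open>\<parallel>f\<parallel>\<^sup>2 \<parallel>S\<parallel> \<le> 12\<^sup>n \<parallel>f\<parallel> \<parallel>F\<parallel> \<parallel>H\<parallel>\<close>, and one factor \<open>\<parallel>f\<parallel>\<close> cancels.

  Tonelli needs \<open>F\<close> and \<open>H\<close> to be measurable: their strict superlevel sets are countable unions of
  sums of compact superlevel sets of the summands. The function \<open>S\<close> is only ever bounded from above
  by measurable functions; moving a constant into its integral is an inequality that holds for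
  arbitrary functions (\<open>cmult_nn_integral_le\<close>).
\<close>

section \<open>Vectors and Lebesgue measure in dimension \<open>n\<close>\<close>

abbreviation Lb :: "nat \<Rightarrow> (nat \<Rightarrow> real) measure" where
  "Lb n \<equiv> (\<Pi>\<^sub>M i\<in>{..<n}. (lborel :: real measure))"

lemma space_Lb [simp]: "space (Lb n) = rspace n"
  by (simp add: space_PiM rspace_def)

lemma topspace_rspace: "topspace (powertop_real {..<n}) = rspace n"
  by (simp add: rspace_def)

lemma vadd_rspace [simp]: "vadd n x y \<in> rspace n"
  by (simp add: vadd_def rspace_def)

lemma vscale_rspace [simp]: "vscale n c x \<in> rspace n"
  by (simp add: vscale_def rspace_def)

lemma vzero_rspace [simp]: "vzero n \<in> rspace n"
  by (simp add: vzero_def rspace_def)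

lemma rspace_eqI:
  assumes "x \<in> rspace n" "y \<in> rspace n" "\<And>i. i < n \<Longrightarrow> x i = y i"
  shows "x = y"
  using assms unfolding rspace_def by (intro PiE_ext) auto

lemma vadd_apply [simp]: "i < n \<Longrightarrow> vadd n x y i = x i + y i"
  by (simp add: vadd_def)

lemma vscale_apply [simp]: "i < n \<Longrightarrow> vscale n c x i = c * x i"
  by (simp add: vscale_def)

lemma vzero_apply [simp]: "i < n \<Longrightarrow> vzero n i = 0"
  by (simp add: vzero_def)

lemma measurable_coordinate:
  assumes "X \<in> measurable M (Lb n)" "i < n"
  shows "(\<lambda>w. X w i) \<in> borel_measurable M"
  using measurable_compose[OF assms(1) measurable_component_singleton[of i]] assms(2) by simp

lemma measurable_vadd [measurable]:
  assumes [measurable]: "X \<in> measurable M (Lb n)" "Y \<in> measurable M (Lb n)"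
  shows "(\<lambda>w. vadd n (X w) (Y w)) \<in> measurable M (Lb n)"
  unfolding vadd_def
proof (rule measurable_restrict)
  fix i assume i: "i \<in> {..<n}"
  have "(\<lambda>w. X w i) \<in> borel_measurable M" "(\<lambda>w. Y w i) \<in> borel_measurable M"
    using i assms by (auto intro!: measurable_coordinate[where n=n])
  then show "(\<lambda>w. X w i + Y w i) \<in> measurable M lborel" by simp
qed

lemma measurable_vscale [measurable]:
  assumes [measurable]: "X \<in> measurable M (Lb n)"
  shows "(\<lambda>w. vscale n c (X w)) \<in> measurable M (Lb n)"
  unfolding vscale_def
proof (rule measurable_restrict)
  fix i assume i: "i \<in> {..<n}"
  have "(\<lambda>w. X w i) \<in> borel_measurable M"
    using i assms by (auto intro!: measurable_coordinate[where n=n])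
  then show "(\<lambda>w. c * X w i) \<in> measurable M lborel" by simp
qed

text \<open>
  A product measure is determined by its values on boxes, so the scaling law of Lebesgue measure
  on the line, applied in each coordinate, yields the factor \<open>\<bar>c\<bar> ^ n\<close>.
\<close>

lemma nn_integral_Lb_affine:
  assumes phi [measurable]: "\<phi> \<in> borel_measurable (Lb n)" and p: "p \<in> rspace n" and c: "c \<noteq> 0"
  shows "(\<integral>\<^sup>+x. \<phi> x \<partial>Lb n) = ennreal (\<bar>c\<bar> ^ n) * (\<integral>\<^sup>+x. \<phi> (vadd n p (vscale n c x)) \<partial>Lb n)"
proof -
  interpret product_sigma_finite "\<lambda>_::nat. lborel :: real measure"
    by standard
  define T where "T = (\<lambda>x. vadd n p (vscale n c x))"
  have pm: "(\<lambda>_. p) \<in> measurable (Lb n) (Lb n)" using p by simp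
  have T [measurable]: "T \<in> measurable (Lb n) (Lb n)"
    unfolding T_def using pm by measurable
  have "density (distr (Lb n) (Lb n) T) (\<lambda>_. ennreal (\<bar>c\<bar> ^ n)) = Lb n"
  proof (rule PiM_eqI)
    fix A :: "nat \<Rightarrow> real set" assume A: "\<And>i. i \<in> {..<n} \<Longrightarrow> A i \<in> sets lborel"
    define B where "B i = (\<lambda>x. p i + c * x) -` A i" for i
    have B: "B i \<in> sets lborel" if "i \<in> {..<n}" for i
    proof -
      have "(\<lambda>x::real. p i + c * x) \<in> borel_measurable borel" by measurable
      from measurable_sets[OF this, of "A i"] A[OF that] show ?thesis by (simp add: B_def)
    qed
    have scale: "ennreal \<bar>c\<bar> * emeasure lborel (B i) = emeasure lborel (A i)" if "i \<in> {..<n}" for i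
    proof -
      have Ai: "A i \<in> sets borel" using A[OF that] by simp
      show ?thesis
        by (subst (2) lborel_real_affine[OF c, of "p i"])
           (use Ai in \<open>simp add: emeasure_density nn_integral_distr B_def nn_integral_cmult
              emeasure_distr\<close>)
    qed
    have Am: "Pi\<^sub>E {..<n} A \<in> sets (Lb n)" using A by (intro sets_PiM_I_finite) auto
    have pre: "T -` (Pi\<^sub>E {..<n} A) \<inter> space (Lb n) = Pi\<^sub>E {..<n} B"
    proof (rule set_eqI)
      fix x
      have "T x \<in> extensional {..<n}" by (simp add: T_def vadd_def)
      moreover have "x \<in> space (Lb n) \<longleftrightarrow> x \<in> extensional {..<n}"
        unfolding space_Lb by (simp add: rspace_def PiE_iff)
      moreover have "(\<forall>i\<in>{..<n}. T x i \<in> A i) \<longleftrightarrow> (\<forall>i\<in>{..<n}. x i \<in> B i)"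
        by (simp add: T_def B_def)
      ultimately show "x \<in> T -` (Pi\<^sub>E {..<n} A) \<inter> space (Lb n) \<longleftrightarrow> x \<in> Pi\<^sub>E {..<n} B"
        unfolding PiE_iff Int_iff vimage_eq by blast
    qed
    have "emeasure (density (distr (Lb n) (Lb n) T) (\<lambda>_. ennreal (\<bar>c\<bar> ^ n))) (Pi\<^sub>E {..<n} A)
        = ennreal (\<bar>c\<bar> ^ n) * emeasure (distr (Lb n) (Lb n) T) (Pi\<^sub>E {..<n} A)"
      using Am by (subst emeasure_density_const) auto
    also have "emeasure (distr (Lb n) (Lb n) T) (Pi\<^sub>E {..<n} A) = emeasure (Lb n) (Pi\<^sub>E {..<n} B)"
      using emeasure_distr[OF T Am] unfolding pre .
    also have "ennreal (\<bar>c\<bar> ^ n) * emeasure (Lb n) (Pi\<^sub>E {..<n} B)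
        = (\<Prod>i<n. ennreal \<bar>c\<bar>) * (\<Prod>i<n. emeasure lborel (B i))"
      using B by (subst emeasure_PiM) (auto simp: ennreal_power)
    also have "\<dots> = (\<Prod>i<n. ennreal \<bar>c\<bar> * emeasure lborel (B i))"
      by (rule prod.distrib[symmetric])
    also have "\<dots> = (\<Prod>i<n. emeasure lborel (A i))"
      by (intro prod.cong) (auto simp: scale)
    finally show "emeasure (density (distr (Lb n) (Lb n) T) (\<lambda>_. ennreal (\<bar>c\<bar> ^ n))) (Pi\<^sub>E {..<n} A)
        = (\<Prod>i<n. emeasure lborel (A i))" .
  qed simp_all
  then have "(\<integral>\<^sup>+x. \<phi> x \<partial>Lb n)
      = (\<integral>\<^sup>+x. \<phi> x \<partial>density (distr (Lb n) (Lb n) T) (\<lambda>_. ennreal (\<bar>c\<bar> ^ n)))" by simp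
  also have "\<dots> = ennreal (\<bar>c\<bar> ^ n) * (\<integral>\<^sup>+x. \<phi> (T x) \<partial>Lb n)"
    by (simp add: nn_integral_density nn_integral_distr nn_integral_cmult)
  finally show ?thesis by (simp add: T_def)
qed

text \<open>
  The topology has a countable base of boxes with rational corners, and boxes are measurable. This
  is what connects upper semicontinuity with the product \<open>\<sigma>\<close>-algebra.
\<close>

lemma openin_sets_Lb:
  assumes U: "openin (powertop_real {..<n}) U"
  shows "U \<in> sets (Lb n)"
proof -
  define box where "box = (\<lambda>(a, b). Pi\<^sub>E {..<n} (\<lambda>i. {a i <..< b i :: real}))"
  define D where "D = {ab \<in> (Pi\<^sub>E {..<n} (\<lambda>_. \<rat>)) \<times> (Pi\<^sub>E {..<n} (\<lambda>_. \<rat>)). box ab \<subseteq> U}"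
  have "countable ((Pi\<^sub>E {..<n} (\<lambda>_. \<rat> :: real set)) \<times> (Pi\<^sub>E {..<n} (\<lambda>_. \<rat> :: real set)))"
    by (intro countable_SIGMA countable_PiE countable_rat finite_lessThan)
  then have D: "countable D" by (rule countable_subset[rotated]) (auto simp: D_def)
  have "x \<in> (\<Union>ab\<in>D. box ab)" if xU: "x \<in> U" for x
  proof -
    obtain V where "finite {i \<in> {..<n}. V i \<noteq> topspace euclideanreal} \<and>
        (\<forall>i\<in>{..<n}. openin euclideanreal (V i)) \<and> x \<in> Pi\<^sub>E {..<n} V \<and> Pi\<^sub>E {..<n} V \<subseteq> U"
      using bspec[OF U[unfolded openin_product_topology_alt] xU] by (rule exE)
    then have V: "\<forall>i\<in>{..<n}. openin euclideanreal (V i)"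
        "x \<in> Pi\<^sub>E {..<n} V" "Pi\<^sub>E {..<n} V \<subseteq> U"
      by blast+
    have "\<exists>a b. a \<in> \<rat> \<and> b \<in> \<rat> \<and> x i \<in> {a<..<b} \<and> {a<..<b} \<subseteq> V i" if "i < n" for i
    proof -
      have "open (V i)" "x i \<in> V i"
        using V(1) that PiE_mem[OF V(2), of i] by simp_all
      then obtain e where e: "e > 0" "ball (x i) e \<subseteq> V i" by (auto simp: open_contains_ball)
      obtain a where a: "a \<in> \<rat>" "x i - e < a" "a < x i"
        using Rats_dense_in_real[of "x i - e" "x i"] e by auto
      obtain b where b: "b \<in> \<rat>" "x i < b" "b < x i + e"
        using Rats_dense_in_real[of "x i" "x i + e"] e by auto
      have "{a<..<b} \<subseteq> ball (x i) e" using a b by (auto simp: dist_real_def)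
      with a b e show ?thesis by (intro exI[of _ a] exI[of _ b]) auto
    qed
    then obtain a b where ab:
      "\<And>i. i < n \<Longrightarrow> a i \<in> \<rat> \<and> b i \<in> \<rat> \<and> x i \<in> {a i<..<b i} \<and> {a i<..<b i} \<subseteq> V i" by metis
    have "x \<in> box (restrict a {..<n}, restrict b {..<n})"
      using ab V(2) by (auto simp: box_def PiE_iff)
    moreover have "(restrict a {..<n}, restrict b {..<n}) \<in> D"
    proof -
      have "box (restrict a {..<n}, restrict b {..<n}) \<subseteq> Pi\<^sub>E {..<n} V"
        unfolding box_def prod.case by (rule PiE_mono) (use ab in simp)
      with V(3) have "box (restrict a {..<n}, restrict b {..<n}) \<subseteq> U" by (rule order_trans[rotated])
      with ab show ?thesis by (simp add: D_def)
    qed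
    ultimately show ?thesis by (rule UN_I[rotated])
  qed
  moreover have "box ab \<subseteq> U" if "ab \<in> D" for ab using that by (simp add: D_def)
  ultimately have "U = (\<Union>ab\<in>D. box ab)" by blast
  also have "\<dots> \<in> sets (Lb n)"
    using D by (intro sets.countable_UN'') (auto simp: box_def split_beta intro!: sets_PiM_I_finite)
  finally show ?thesis .
qed

lemma compactin_sumset:
  assumes "compactin (powertop_real {..<n}) A" "compactin (powertop_real {..<n}) B"
  shows "compactin (powertop_real {..<n}) ((\<lambda>(y, z). vadd n y z) ` (A \<times> B))"
proof (rule image_compactin)
  let ?X = "powertop_real {..<n}"
  show "compactin (prod_topology ?X ?X) (A \<times> B)"
    using assms by (simp add: compactin_Times)
  show "continuous_map (prod_topology ?X ?X) ?X (\<lambda>(y, z). vadd n y z)"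
    unfolding continuous_map_componentwise
  proof (intro conjI ballI)
    show "(\<lambda>(y, z). vadd n y z) ` topspace (prod_topology ?X ?X) \<subseteq> extensional {..<n}"
      by (auto simp: vadd_def)
    fix i assume i: "i \<in> {..<n}"
    have "continuous_map (prod_topology ?X ?X) euclideanreal (\<lambda>w. fst w i)"
      using continuous_map_compose[OF continuous_map_fst continuous_map_product_projection[OF i]]
      unfolding o_def .
    moreover have "continuous_map (prod_topology ?X ?X) euclideanreal (\<lambda>w. snd w i)"
      using continuous_map_compose[OF continuous_map_snd continuous_map_product_projection[OF i]]
      unfolding o_def .
    ultimately have "continuous_map (prod_topology ?X ?X) euclideanreal (\<lambda>w. fst w i + snd w i)"
      by (rule continuous_map_add)
    then show "continuous_map (prod_topology ?X ?X) euclideanreal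
        (\<lambda>w. (case w of (y, z) \<Rightarrow> vadd n y z) i)"
      using i by (simp add: split_beta)
  qed
qed

lemma compactin_sets_Lb:
  assumes "compactin (powertop_real {..<n}) K"
  shows "K \<in> sets (Lb n)"
proof -
  have "Hausdorff_space (powertop_real {..<n})"
    by (simp add: Hausdorff_space_product_topology)
  with assms have cl: "closedin (powertop_real {..<n}) K"
    by (rule compactin_imp_closedin[rotated])
  then have "rspace n - K \<in> sets (Lb n)"
    by (intro openin_sets_Lb) (auto simp: closedin_def rspace_def)
  then have "space (Lb n) - (rspace n - K) \<in> sets (Lb n)" by (rule sets.compl_sets)
  moreover have "K \<subseteq> rspace n" using closedin_subset[OF cl] by (simp add: rspace_def)
  ultimately show ?thesis unfolding space_Lb by (metis double_diff subset_refl)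
qed

section \<open>The class of functions\<close>

lemma CclassD:
  assumes "f \<in> Cclass n \<alpha>"
  shows "upper_semicontinuous n f" "alpha_concave n \<alpha> f"
    "(SUP x\<in>rspace n. ereal \<bar>f x\<bar>) = 1" "f (vzero n) = 1" "vanishes_at_infinity n f"
  using assms unfolding Cclass_def mem_Collect_eq by blast+

lemma Cclass_bounds:
  assumes "f \<in> Cclass n \<alpha>" "x \<in> rspace n"
  shows "0 \<le> f x" "f x \<le> 1"
proof -
  show "0 \<le> f x" 
    using CclassD(2)[OF assms(1)] assms(2) by (simp add: alpha_concave_def)
  have "ereal \<bar>f x\<bar> \<le> (SUP x\<in>rspace n. ereal \<bar>f x\<bar>)" using assms by (intro SUP_upper)
  also have "\<dots> = 1" by (rule CclassD(3)[OF assms(1)])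
  finally show "f x \<le> 1" by simp
qed

lemma Cclass_measurable:
  assumes "f \<in> Cclass n \<alpha>"
  shows "f \<in> borel_measurable (Lb n)"
  unfolding borel_measurable_iff_less
proof
  fix t
  have "openin (powertop_real {..<n}) {x \<in> rspace n. f x < t}"
    using CclassD(1)[OF assms] by (simp add: upper_semicontinuous_def)
  then show "{x \<in> space (Lb n). f x < t} \<in> sets (Lb n)"
    unfolding space_Lb by (rule openin_sets_Lb)
qed

text \<open>
  Semicontinuity makes the superlevel set closed; vanishing at infinity confines it to a cube.
\<close>

lemma Cclass_compact_superlevel:
  assumes f: "f \<in> Cclass n \<alpha>" and s: "0 < s"
  shows "compactin (powertop_real {..<n}) {x \<in> rspace n. s \<le> f x}"
proof -
  let ?X = "powertop_real {..<n}"
  have "openin ?X {x \<in> rspace n. f x < s}"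
    using CclassD(1)[OF f] by (simp add: upper_semicontinuous_def)
  then have "closedin ?X (topspace ?X - {x \<in> rspace n. f x < s})" by blast
  moreover have "topspace ?X - {x \<in> rspace n. f x < s} = {x \<in> rspace n. s \<le> f x}"
    unfolding topspace_rspace by auto
  ultimately have cl: "closedin ?X {x \<in> rspace n. s \<le> f x}" by simp
  have "\<forall>\<^sub>F x in inf (filtercomap (vnorm n) at_top) (principal (rspace n)). f x < s"
    using order_tendstoD(2)[OF CclassD(5)[OF f, unfolded vanishes_at_infinity_def] s] .
  then obtain N where N: "\<And>x. N \<le> vnorm n x \<Longrightarrow> x \<in> rspace n \<Longrightarrow> f x < s"
    by (auto simp: eventually_inf_principal eventually_filtercomap_at_top_linorder)
  have "x \<in> Pi\<^sub>E {..<n} (\<lambda>_. {-N..N})" if x: "x \<in> rspace n" "s \<le> f x" for x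
  proof -
    have "\<bar>x i\<bar> \<le> N" if "i < n" for i
    proof -
      have "\<bar>x i\<bar> \<le> L2_set (\<lambda>i. \<bar>x i\<bar>) {..<n}" using that by (intro member_le_L2_set) auto
      also have "\<dots> = vnorm n x" by (simp add: vnorm_def L2_set_def)
      also have "\<dots> \<le> N" using N[OF _ x(1)] x(2) by force
      finally show ?thesis .
    qed
    with x(1) show ?thesis by (force simp: rspace_def PiE_iff abs_le_iff)
  qed
  then have bounded: "{x \<in> rspace n. s \<le> f x} = {x \<in> rspace n. s \<le> f x} \<inter> Pi\<^sub>E {..<n} (\<lambda>_. {-N..N})"
    by auto
  have box: "compactin ?X (Pi\<^sub>E {..<n} (\<lambda>_. {-N..N}))"
    by (simp add: compactin_PiE)
  show ?thesis using closed_Int_compactin[OF cl box] by (simp only: bounded[symmetric])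
qed

text \<open>
  At zeros of \<open>f\<close> the left-hand side vanishes: \<open>0 powr l = 0\<close>, also for \<open>l = 0\<close>.
\<close>

lemma Cclass_log_concave:
  assumes "f \<in> Cclass n 0" "x \<in> rspace n" "y \<in> rspace n" "0 \<le> l" "l \<le> 1"
  shows "f x powr l * f y powr (1 - l) \<le> f (vadd n (vscale n l x) (vscale n (1 - l) y))"
proof (cases "f x > 0 \<and> f y > 0")
  case True
  have "\<forall>x\<in>rspace n. \<forall>y\<in>rspace n. \<forall>l\<in>{0..1}. f x > 0 \<longrightarrow> f y > 0 \<longrightarrow>
      alpha_mean 0 l (f x) (f y) \<le> f (vadd n (vscale n l x) (vscale n (1 - l) y))"
    using CclassD(2)[OF assms(1)] unfolding alpha_concave_def by (rule conjunct2)
  with True assms(2-5) have "alpha_mean 0 l (f x) (f y) \<le> f (vadd n (vscale n l x) (vscale n (1 - l) y))"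
    by simp
  then show ?thesis by (simp add: alpha_mean_def)
next
  case False
  then have "f x powr l * f y powr (1 - l) = 0"
    using Cclass_bounds(1)[OF assms(1,2)] Cclass_bounds(1)[OF assms(1,3)] by auto
  also have "\<dots> \<le> f (vadd n (vscale n l x) (vscale n (1 - l) y))"
    using assms by (intro Cclass_bounds) auto
  finally show ?thesis .
qed

text \<open>
  Log-concavity on the segment from \<open>x\<close> to the origin, where \<open>f\<close> is \<open>1\<close>.
\<close>

lemma Cclass_shrink:
  assumes f: "f \<in> Cclass n 0" and x: "x \<in> rspace n" and l: "0 \<le> l" "l \<le> 1"
  shows "f x powr l \<le> f (vscale n l x)"
proof -
  have "vadd n (vscale n l x) (vscale n (1 - l) (vzero n)) = vscale n l x"
    by (rule rspace_eqI[of _ n]) auto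
  with Cclass_log_concave[OF f x vzero_rspace l] CclassD(4)[OF f] show ?thesis by simp
qed

section \<open>Sums of functions with values in the unit interval\<close>

text \<open>
  For real \<open>\<alpha> = r < 0\<close> write \<open>A = a powr r\<close> and \<open>B = b powr r\<close>. Both are at least \<open>1\<close>, so
  \<open>max A B \<le> A + B - 1 \<le> A * B\<close>, the last step being \<open>0 \<le> (A - 1) * (B - 1)\<close>. The decreasing
  function \<open>\<lambda>x. x powr (1 / r)\<close> maps this to the claim.
\<close>

lemma alpha_comb_bounds:
  assumes \<alpha>: "\<alpha> \<le> 0" and a: "0 \<le> a" "a \<le> 1" and b: "0 \<le> b" "b \<le> 1"
  shows "a * b \<le> alpha_comb \<alpha> a b" "alpha_comb \<alpha> a b \<le> min a b"
proof -
  have prod_min: "a * b \<le> min a b"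
    using a b by (simp add: mult_left_le mult_left_le_one_le)
  have "a * b \<le> alpha_comb \<alpha> a b \<and> alpha_comb \<alpha> a b \<le> min a b"
  proof (cases "\<alpha> = -\<infinity> \<or> \<alpha> = 0 \<or> a = 0 \<or> b = 0")
    case True
    then show ?thesis using prod_min a b by (auto simp: alpha_comb_def)
  next
    case False
    with \<alpha> obtain r where r: "\<alpha> = ereal r" "r < 0" by (cases \<alpha>) auto
    define A B where "A = a powr r" and "B = b powr r"
    have ab: "0 < a" "0 < b" using False a b by auto
    have A: "1 \<le> A" and B: "1 \<le> B"
      using ab a b r powr_mono2'[of r a 1] powr_mono2'[of r b 1]
      by (auto simp: A_def B_def) 
    have inv: "A powr (1 / r) = a" "B powr (1 / r) = b"
      using ab r by (auto simp: A_def B_def powr_powr)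
    have "(A * B) powr (1 / r) \<le> (A + B - 1) powr (1 / r)"
    proof (rule powr_mono2')
      have "0 \<le> (A - 1) * (B - 1)" using A B by simp
      then show "A + B - 1 \<le> A * B" by (simp add: algebra_simps)
    qed (use r A B in auto)
    moreover have "(A + B - 1) powr (1 / r) \<le> A powr (1 / r)"
      "(A + B - 1) powr (1 / r) \<le> B powr (1 / r)"
      using A B r by (intro powr_mono2'; simp)+
    moreover have "(A * B) powr (1 / r) = a * b"
      using A B inv by (simp add: powr_mult)
    moreover have "alpha_comb \<alpha> a b = (A + B - 1) powr (1 / r)"
      using False r by (simp add: alpha_comb_def A_def B_def)
    ultimately show ?thesis using inv by simp
  qed
  then show "a * b \<le> alpha_comb \<alpha> a b" "alpha_comb \<alpha> a b \<le> min a b" by auto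
qed


text \<open>
  The class itself is not obviously closed under the sums; this property is, and it suffices to make
  the suprema genuine, also in the iterated sum.
\<close>

definition unit_valued :: "nat \<Rightarrow> ((nat \<Rightarrow> real) \<Rightarrow> real) \<Rightarrow> bool" where
  "unit_valued n f \<longleftrightarrow> (\<forall>x\<in>rspace n. 0 \<le> f x \<and> f x \<le> 1)"

lemma unit_valuedD:
  assumes "unit_valued n f" "x \<in> rspace n"
  shows "0 \<le> f x" "f x \<le> 1"
  using assms by (simp_all add: unit_valued_def)

lemma Cclass_unit_valued: "f \<in> Cclass n \<alpha> \<Longrightarrow> unit_valued n f"
  by (simp add: unit_valued_def Cclass_bounds)

lemma vadd_vzero: "x \<in> rspace n \<Longrightarrow> vadd n x (vzero n) = x"
  by (rule rspace_eqI[of _ n]) auto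

context
  fixes n :: nat and \<alpha> :: ereal and f g :: "(nat \<Rightarrow> real) \<Rightarrow> real"
  assumes \<alpha>: "\<alpha> \<le> 0" and f: "unit_valued n f" and g: "unit_valued n g"
begin

private definition "vals x = {alpha_comb \<alpha> (f y) (g z) | y z. y \<in> rspace n \<and> z \<in> rspace n \<and> vadd n y z = x}"

private lemma alpha_sum_vals: "alpha_sum n \<alpha> f g x = Sup (vals x)"
  by (simp add: alpha_sum_def vals_def)

private lemma vals_le_1: "v \<in> vals x \<Longrightarrow> v \<le> 1"
  using alpha_comb_bounds(2)[OF \<alpha> unit_valuedD[OF f] unit_valuedD[OF g]] unit_valuedD(2)[OF f]
  by (fastforce simp: vals_def)

private lemma bdd_above_vals: "bdd_above (vals x)"
  by (rule bdd_aboveI[of _ 1]) (rule vals_le_1)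

private lemma vals_nonempty: "x \<in> rspace n \<Longrightarrow> vals x \<noteq> {}"
  using vadd_vzero[of x n] vzero_rspace[of n] unfolding vals_def by blast

lemma mult_le_alpha_sum:
  assumes "y \<in> rspace n" "z \<in> rspace n"
  shows "f y * g z \<le> alpha_sum n \<alpha> f g (vadd n y z)"
proof -
  have "f y * g z \<le> alpha_comb \<alpha> (f y) (g z)"
    by (intro alpha_comb_bounds \<alpha> unit_valuedD[OF f] unit_valuedD[OF g] assms)
  also have "\<dots> \<le> Sup (vals (vadd n y z))"
    using assms by (intro cSup_upper bdd_above_vals) (auto simp: vals_def)
  finally show ?thesis by (simp add: alpha_sum_vals)
qed

lemma less_alpha_sumE:
  assumes "x \<in> rspace n" "t < alpha_sum n \<alpha> f g x"
  obtains y z where "y \<in> rspace n" "z \<in> rspace n" "vadd n y z = x"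
    "t < alpha_comb \<alpha> (f y) (g z)" "t < f y" "t < g z"
proof -
  obtain v where v: "v \<in> vals x" "t < v"
    using less_cSupE[OF assms(2)[unfolded alpha_sum_vals] vals_nonempty[OF assms(1)]] by blast
  then obtain y z where yz: "y \<in> rspace n" "z \<in> rspace n" "vadd n y z = x"
    "t < alpha_comb \<alpha> (f y) (g z)" unfolding vals_def by blast
  moreover have "alpha_comb \<alpha> (f y) (g z) \<le> min (f y) (g z)"
    by (intro alpha_comb_bounds \<alpha> unit_valuedD[OF f] unit_valuedD[OF g] yz)
  ultimately show ?thesis using that by force
qed

lemma alpha_sum_unit_valued: "unit_valued n (alpha_sum n \<alpha> f g)"
  unfolding unit_valued_def
proof (intro ballI conjI)
  fix x assume x: "x \<in> rspace n"
  have "0 \<le> f x * g (vzero n)"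
    using unit_valuedD(1)[OF f x] unit_valuedD(1)[OF g vzero_rspace] by simp
  also have "\<dots> \<le> alpha_sum n \<alpha> f g x"
    using mult_le_alpha_sum[OF x vzero_rspace] x by (simp add: vadd_vzero)
  finally show "0 \<le> alpha_sum n \<alpha> f g x" .
  show "alpha_sum n \<alpha> f g x \<le> 1"
    unfolding alpha_sum_vals by (rule cSup_least[OF vals_nonempty[OF x] vals_le_1])
qed

end

lemma less_zero_sumE:
  assumes "unit_valued n f" "unit_valued n g" "x \<in> rspace n" "t < alpha_sum n 0 f g x"
  obtains y z where "y \<in> rspace n" "z \<in> rspace n" "vadd n y z = x" "t < f y * g z"
proof (rule less_alpha_sumE[OF order_refl assms])
  fix y z assume "y \<in> rspace n" "z \<in> rspace n" "vadd n y z = x" "t < alpha_comb 0 (f y) (g z)"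
  then show ?thesis by (intro that[of y z]) (simp_all add: alpha_comb_def)
qed

lemma zero_sum_le_alpha_sum:
  assumes \<beta>: "\<beta> \<le> 0" and f: "unit_valued n f" and g: "unit_valued n g" and x: "x \<in> rspace n"
  shows "alpha_sum n 0 f g x \<le> alpha_sum n \<beta> f g x"
proof (rule dense_le)
  fix t assume "t < alpha_sum n 0 f g x"
  then obtain y z where yz: "y \<in> rspace n" "z \<in> rspace n" "vadd n y z = x" "t < f y * g z"
    using less_zero_sumE[OF f g x] by blast
  with mult_le_alpha_sum[OF \<beta> f g yz(1,2)] show "t \<le> alpha_sum n \<beta> f g x" by simp
qed

text \<open>
  A product exceeds \<open>t \<ge> 0\<close> iff its factors dominate rationals \<open>p, q > 0\<close> with \<open>p * q > t\<close>. Hence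
  \<open>{f \<star>\<^sub>0 g > t}\<close> is the countable union of the Minkowski sums \<open>{f \<ge> p} + {g \<ge> q}\<close>. These are
  compact, whereas sums of general measurable sets need not be measurable.
\<close>

lemma measurable_zero_sum:
  assumes f: "f \<in> Cclass n \<gamma>" and g: "g \<in> Cclass n \<delta>"
  shows "alpha_sum n 0 f g \<in> borel_measurable (Lb n)"
  unfolding borel_measurable_iff_greater
proof
  fix t :: real
  note uf = Cclass_unit_valued[OF f] and ug = Cclass_unit_valued[OF g]
  let ?F = "alpha_sum n 0 f g"
  show "{x \<in> space (Lb n). t < ?F x} \<in> sets (Lb n)"
  proof (cases "t < 0")
    case True
    then have all: "{x \<in> space (Lb n). t < ?F x} = space (Lb n)"
      using unit_valuedD(1)[OF alpha_sum_unit_valued[OF order_refl uf ug]] by force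
    show ?thesis unfolding all by (rule sets.top)
  next
    case False
    define P where "P = {pq. pq \<in> \<rat> \<times> \<rat> \<and> 0 < fst pq \<and> 0 < snd pq \<and> t < fst pq * (snd pq :: real)}"
    define E where "E = (\<lambda>(p, q). (\<lambda>(y, z). vadd n y z) `
      ({x \<in> rspace n. p \<le> f x} \<times> {x \<in> rspace n. q \<le> g x}))"
    have P: "countable P"
      by (rule countable_subset[of _ "\<rat> \<times> \<rat>"]) (auto simp: P_def intro: countable_SIGMA countable_rat)
    have "E pq \<in> sets (Lb n)" if "pq \<in> P" for pq
      using that Cclass_compact_superlevel[OF f] Cclass_compact_superlevel[OF g]
      by (auto simp: P_def E_def split_beta intro!: compactin_sets_Lb compactin_sumset[unfolded split_beta])
    with P have "(\<Union>pq\<in>P. E pq) \<in> sets (Lb n)" by (intro sets.countable_UN'') auto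
    moreover have "{x \<in> space (Lb n). t < ?F x} = (\<Union>pq\<in>P. E pq)"
    proof (intro equalityI subsetI)
      fix x assume "x \<in> {x \<in> space (Lb n). t < ?F x}"
      then have x: "x \<in> rspace n" "t < ?F x" by simp_all
      obtain y z where yz: "y \<in> rspace n" "z \<in> rspace n" "vadd n y z = x" "t < f y * g z"
        using less_zero_sumE[OF uf ug x] by blast
      have fg: "0 < f y" "0 < g z"
      proof -
        have "0 < f y * g z" using False yz by simp
        then show "0 < f y" "0 < g z"
          using unit_valuedD(1)[OF uf yz(1)] unit_valuedD(1)[OF ug yz(2)]
          by (auto simp: zero_less_mult_iff)
      qed
      have "max 0 (t / g z) < f y" using yz fg by (simp add: field_simps)
      then obtain p where p: "p \<in> \<rat>" "max 0 (t / g z) < p" "p < f y"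
        using Rats_dense_in_real by blast
      have "max 0 (t / p) < g z" using p fg by (simp add: field_simps)
      then obtain q where q: "q \<in> \<rat>" "max 0 (t / p) < q" "q < g z"
        using Rats_dense_in_real by blast
      have "(p, q) \<in> P" using p q by (simp add: P_def field_simps)
      moreover have "x \<in> E (p, q)"
        using yz p q unfolding E_def prod.case by (intro image_eqI[of _ _ "(y, z)"]) auto
      ultimately show "x \<in> (\<Union>pq\<in>P. E pq)" by blast
    next
      fix x assume "x \<in> (\<Union>pq\<in>P. E pq)"
      then obtain p q y z where pq: "0 < p" "0 < q" "t < p * q"
        and yz: "y \<in> rspace n" "z \<in> rspace n" "p \<le> f y" "q \<le> g z" "x = vadd n y z"
        by (auto simp: P_def E_def)
      have "t < p * q" by fact
      also have "\<dots> \<le> f y * g z" using pq yz by (intro mult_mono) auto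
      also have "\<dots> \<le> ?F x" using mult_le_alpha_sum[OF order_refl uf ug yz(1,2)] yz by simp
      finally show "x \<in> {x \<in> space (Lb n). t < ?F x}" using yz by simp
    qed
    ultimately show ?thesis by simp
  qed
qed


section \<open>Convolution and constant factors\<close>

abbreviation vdiff :: "nat \<Rightarrow> (nat \<Rightarrow> real) \<Rightarrow> (nat \<Rightarrow> real) \<Rightarrow> nat \<Rightarrow> real" where
  "vdiff n x y \<equiv> vadd n x (vscale n (- 1) y)"

lemma sigma_finite_Lb: "sigma_finite_measure (Lb n)"
proof -
  interpret product_sigma_finite "\<lambda>_::nat. lborel :: real measure"
    by standard
  show ?thesis by (rule sigma_finite) simp
qed

lemma nn_integral_convolution:
  assumes F [measurable]: "F \<in> borel_measurable (Lb n)" and H [measurable]: "H \<in> borel_measurable (Lb n)"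
  shows "(\<integral>\<^sup>+x. \<integral>\<^sup>+u. F u * H (vdiff n x u) \<partial>Lb n \<partial>Lb n) = (\<integral>\<^sup>+u. F u \<partial>Lb n) * (\<integral>\<^sup>+v. H v \<partial>Lb n)"
proof -
  interpret sigma_finite_measure "Lb n" by (rule sigma_finite_Lb)
  interpret pair_sigma_finite "Lb n" "Lb n" by standard
  have "(\<integral>\<^sup>+x. \<integral>\<^sup>+u. F u * H (vdiff n x u) \<partial>Lb n \<partial>Lb n)
      = (\<integral>\<^sup>+u. \<integral>\<^sup>+x. F u * H (vdiff n x u) \<partial>Lb n \<partial>Lb n)"
    by (rule Fubini') measurable
  also have "\<dots> = (\<integral>\<^sup>+u. F u * (\<integral>\<^sup>+v. H v \<partial>Lb n) \<partial>Lb n)"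
  proof (rule nn_integral_cong)
    fix u assume u: "u \<in> space (Lb n)"
    then have [measurable]: "(\<lambda>x. vdiff n x u) \<in> measurable (Lb n) (Lb n)" by measurable
    have "(\<integral>\<^sup>+x. H (vdiff n x u) \<partial>Lb n)
        = (\<integral>\<^sup>+x. H (vadd n (vscale n (- 1) u) (vscale n 1 x)) \<partial>Lb n)"
      by (intro nn_integral_cong arg_cong[of _ _ H] rspace_eqI[of _ n]) auto
    also have "\<dots> = (\<integral>\<^sup>+v. H v \<partial>Lb n)"
      by (subst nn_integral_Lb_affine[OF H vscale_rspace, of 1]) auto
    finally show "(\<integral>\<^sup>+x. F u * H (vdiff n x u) \<partial>Lb n) = F u * (\<integral>\<^sup>+v. H v \<partial>Lb n)"
      by (subst nn_integral_cmult) auto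
  qed
  also have "\<dots> = (\<integral>\<^sup>+u. F u \<partial>Lb n) * (\<integral>\<^sup>+v. H v \<partial>Lb n)"
    by (rule nn_integral_multc) fact
  finally show ?thesis .
qed

lemma numeral_power_cancel: "(numeral k :: ennreal) ^ n * ennreal (\<bar>1 / numeral k\<bar> ^ n) = 1"
proof -
  have "(numeral k :: ennreal) ^ n * ennreal (\<bar>1 / numeral k\<bar> ^ n)
      = ennreal (numeral k ^ n) * ennreal ((1 / numeral k) ^ n)"
    by (simp flip: ennreal_power)
  also have "\<dots> = ennreal ((numeral k * (1 / numeral k)) ^ n)"
    by (subst ennreal_mult[symmetric]) (simp_all add: power_mult_distrib del: times_divide_eq_right)
  finally show ?thesis by simp
qed

text \<open>
  The integral of any function, measurable or not, is a supremum over simple functions below it, and a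
  constant multiple of such a simple function is still below the multiplied integrand.
\<close>

lemma cmult_nn_integral_le: "c * (\<integral>\<^sup>+x. S x \<partial>M) \<le> (\<integral>\<^sup>+x. c * S x \<partial>M)"
proof -
  have "c * (SUP s\<in>{s. simple_function M s \<and> s \<le> S}. integral\<^sup>S M s)
      = (SUP s\<in>{s. simple_function M s \<and> s \<le> S}. c * integral\<^sup>S M s)"
    by (rule SUP_mult_left_ennreal)
  also have "\<dots> \<le> (\<integral>\<^sup>+x. c * S x \<partial>M)"
  proof (rule SUP_least)
    fix s assume s: "s \<in> {s. simple_function M s \<and> s \<le> S}"
    then have "c * integral\<^sup>S M s = (\<integral>\<^sup>+x. c * s x \<partial>M)"
      by (subst nn_integral_cmult) (auto simp: borel_measurable_simple_function nn_integral_eq_simple_integral)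
    also have "\<dots> \<le> (\<integral>\<^sup>+x. c * S x \<partial>M)"
      using s by (intro nn_integral_mono mult_left_mono) (auto simp: le_fun_def)
    finally show "c * integral\<^sup>S M s \<le> (\<integral>\<^sup>+x. c * S x \<partial>M)" .
  qed
  finally show ?thesis by (simp add: nn_integral_def)
qed

section \<open>The overlap inequality\<close>

text \<open>
  The weights leave exactly \<open>sqrt t\<close>: the point \<open>w/2 + a/6\<close> is the midpoint of \<open>w\<close> and \<open>a/3\<close>, so \<open>f\<close>
  contributes the exponent \<open>1/6\<close> of \<open>t\<close>, and \<open>g\<close> at \<open>b/3\<close> contributes \<open>1/3\<close>.
\<close>

lemma zero_sum_lower_bound:
  assumes f: "f \<in> Cclass n 0" and g: "g \<in> Cclass n 0"
    and w: "w \<in> rspace n" and a: "a \<in> rspace n" and b: "b \<in> rspace n"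
    and t: "0 < t" "t \<le> f a" "t \<le> g b"
  shows "sqrt (f w) * sqrt t \<le> alpha_sum n 0 f g
      (vadd n (vadd n (vscale n (1/6) a) (vscale n (1/3) b)) (vscale n (1/2) w))"
proof -
  note uf = Cclass_unit_valued[OF f] and ug = Cclass_unit_valued[OF g]
  define y where "y = vadd n (vscale n (1/2) w) (vscale n (1 - 1/2) (vscale n (1/3) a))"
  define z where "z = vscale n (1/3) b"
  have y: "y \<in> rspace n" and z: "z \<in> rspace n" by (simp_all add: y_def z_def)
  have third: "t powr (1/3) \<le> f (vscale n (1/3) a)" "t powr (1/3) \<le> g z"
    using Cclass_shrink[OF f a, of "1/3"] Cclass_shrink[OF g b, of "1/3"]
      powr_mono2[of "1/3" t "f a"] powr_mono2[of "1/3" t "g b"] t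
    by (auto simp: z_def)
  have "sqrt (f w) * t powr (1/6) = f w powr (1/2) * (t powr (1/3)) powr (1 - 1/2)"
    using unit_valuedD(1)[OF uf w] by (simp add: powr_half_sqrt powr_powr)
  also have "\<dots> \<le> f w powr (1/2) * f (vscale n (1/3) a) powr (1 - 1/2)"
    using third by (intro mult_left_mono powr_mono2) auto
  also have "\<dots> \<le> f y" unfolding y_def using Cclass_log_concave[OF f w, of _ "1/2"] by simp
  finally have fy: "sqrt (f w) * t powr (1/6) \<le> f y" .
  have "sqrt t = t powr (1/6 + 1/3)" using t by (simp add: powr_half_sqrt)
  then have "sqrt (f w) * sqrt t = (sqrt (f w) * t powr (1/6)) * t powr (1/3)"
    by (simp only: powr_add mult.assoc)
  also have "\<dots> \<le> f y * g z"
    using fy third unit_valuedD(1)[OF uf] w y by (intro mult_mono) auto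
  also have "\<dots> \<le> alpha_sum n 0 f g (vadd n y z)"
    by (rule mult_le_alpha_sum[OF order_refl uf ug y z])
  also have "vadd n y z = vadd n (vadd n (vscale n (1/6) a) (vscale n (1/3) b)) (vscale n (1/2) w)"
    by (rule rspace_eqI[of _ n]) (auto simp: y_def z_def field_simps)
  finally show ?thesis .
qed

text \<open>
  For \<open>t < S d\<close> a decomposition of \<open>d\<close> can be fixed before integrating over \<open>w\<close>, so no measurable
  choice of decompositions is involved. The supremum \<open>S d\<close> may not be attained, so the bound is shown for
  \<open>t = r * S d\<close> with \<open>r < 1\<close>, and \<open>r\<close> then tends to \<open>1\<close>.
\<close>

lemma overlap_bound:
  fixes f g h n x0 \<alpha>
  defines "F \<equiv> alpha_sum n 0 f g" and "H \<equiv> alpha_sum n 0 f h"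
    and "S \<equiv> alpha_sum n \<alpha> (alpha_sum n \<alpha> f g) h"
  assumes \<alpha>: "\<alpha> \<le> 0" and f: "f \<in> Cclass n 0" and g: "g \<in> Cclass n 0" and h: "h \<in> Cclass n 0"
    and d: "d \<in> rspace n" and x0: "x0 \<in> rspace n"
  shows "ennreal (S d) * (\<integral>\<^sup>+w. ennreal (sqrt (f w * f (vdiff n x0 w))) \<partial>Lb n)
    \<le> 2 ^ n * (\<integral>\<^sup>+u. ennreal (F u) * ennreal (H (vdiff n (vadd n (vscale n (1/2) x0) (vscale n (1/3) d)) u)) \<partial>Lb n)"
    (is "_ * ?K \<le> 2 ^ n * ?I")
proof (rule ennreal_approx_unit)
  note uf = Cclass_unit_valued[OF f] and ug = Cclass_unit_valued[OF g] and uh = Cclass_unit_valued[OF h]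
  note ufg = alpha_sum_unit_valued[OF \<alpha> uf ug]
  note [measurable] = Cclass_measurable[OF f]
  have F [measurable]: "F \<in> borel_measurable (Lb n)" and H [measurable]: "H \<in> borel_measurable (Lb n)"
    unfolding F_def H_def by (rule measurable_zero_sum[OF f g] measurable_zero_sum[OF f h])+
  fix r' :: ennreal assume r': "0 < r'" "r' < 1"
  then obtain r where r: "r' = ennreal r" "0 < r" "r < 1"
    by (cases r') (auto simp: ennreal_less_iff)
  show "r' * (ennreal (S d) * ?K) \<le> 2 ^ n * ?I"
  proof (cases "S d \<le> 0")
    case True
    then show ?thesis by (simp add: ennreal_neg)
  next
    case False
    define t where "t = r * S d"
    have t: "0 < t" "t < S d" using False r by (simp_all add: t_def)
    obtain e c where e: "e \<in> rspace n" "c \<in> rspace n" "vadd n e c = d"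
        "t < alpha_sum n \<alpha> f g e" "t < h c"
      using less_alpha_sumE[OF \<alpha> ufg uh d t(2)[unfolded S_def]] by blast
    obtain a b where ab: "a \<in> rspace n" "b \<in> rspace n" "vadd n a b = e" "t < f a" "t < g b"
      using less_alpha_sumE[OF \<alpha> uf ug e(1,4)] by blast
    define x where "x = vadd n (vscale n (1/2) x0) (vscale n (1/3) d)"
    define p where "p = vadd n (vscale n (1/6) a) (vscale n (1/3) b)"
    define q where "q = vadd n (vscale n (1/6) a) (vscale n (1/3) c)"
    have xr: "x \<in> rspace n" and pr: "p \<in> rspace n" by (simp_all add: x_def p_def)
    have [measurable]: "(\<lambda>u. vdiff n x u) \<in> measurable (Lb n) (Lb n)"
        "(\<lambda>u. vdiff n x0 u) \<in> measurable (Lb n) (Lb n)"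
      using xr x0 by (auto intro!: measurable_vadd measurable_vscale)
    \<comment> \<open>The splitting \<open>u + v = x\<^sub>0/2 + d/3\<close>, solved for \<open>v\<close>.\<close>
    have xq: "vdiff n x (vadd n p (vscale n (1/2) w)) = vadd n q (vscale n (1/2) (vdiff n x0 w))" for w
      by (rule rspace_eqI[of _ n]) (auto simp: x_def p_def q_def e(3)[symmetric] ab(3)[symmetric] field_simps)
    have "r' * (ennreal (S d) * ?K) = ennreal t * ?K"
      using r False by (simp add: t_def ennreal_mult mult.assoc)
    also have "\<dots> = (\<integral>\<^sup>+w. ennreal t * ennreal (sqrt (f w * f (vdiff n x0 w))) \<partial>Lb n)"
      by (rule nn_integral_cmult[symmetric]) measurable
    also have "\<dots> \<le> (\<integral>\<^sup>+w. ennreal (F (vadd n p (vscale n (1/2) w))) *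
        ennreal (H (vdiff n x (vadd n p (vscale n (1/2) w)))) \<partial>Lb n)"
    proof (rule nn_integral_mono)
      fix w assume "w \<in> space (Lb n)"
      then have w: "w \<in> rspace n" by simp
      have Fw: "sqrt (f w) * sqrt t \<le> F (vadd n p (vscale n (1/2) w))"
        unfolding F_def p_def using zero_sum_lower_bound[OF f g w ab(1,2)] t ab by simp
      have Hw: "sqrt (f (vdiff n x0 w)) * sqrt t \<le> H (vadd n q (vscale n (1/2) (vdiff n x0 w)))"
        unfolding H_def q_def using zero_sum_lower_bound[OF f h vadd_rspace ab(1) e(2)] t ab e by simp
      have nn: "0 \<le> f w" "0 \<le> f (vdiff n x0 w)" using unit_valuedD(1)[OF uf] w by simp_all
      have "t * sqrt (f w * f (vdiff n x0 w)) = (sqrt (f w) * sqrt t) * (sqrt (f (vdiff n x0 w)) * sqrt t)"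
        using t by (simp add: real_sqrt_mult)
      also have "\<dots> \<le> F (vadd n p (vscale n (1/2) w)) * H (vdiff n x (vadd n p (vscale n (1/2) w)))"
        unfolding xq using Fw Hw nn t
        by (intro mult_mono) (auto intro: order_trans[rotated])
      finally show "ennreal t * ennreal (sqrt (f w * f (vdiff n x0 w)))
          \<le> ennreal (F (vadd n p (vscale n (1/2) w))) * ennreal (H (vdiff n x (vadd n p (vscale n (1/2) w))))"
        using t nn alpha_sum_unit_valued[OF order_refl uf ug] alpha_sum_unit_valued[OF order_refl uf uh]
        by (simp add: ennreal_mult[symmetric] unit_valuedD F_def H_def ennreal_leI)
    qed
    also have "\<dots> = 2 ^ n * (ennreal (\<bar>1/2\<bar> ^ n) * \<dots>)"
      unfolding mult.assoc[symmetric] numeral_power_cancel by simp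
    also have "\<dots> = 2 ^ n * ?I"
      unfolding x_def[symmetric]
      by (subst nn_integral_Lb_affine[OF _ pr, of _ "1/2"]) measurable
    finally show ?thesis .
  qed
qed

lemma L1norm_unit_valued:
  "unit_valued n f \<Longrightarrow> L1norm n f = (\<integral>\<^sup>+x. ennreal (f x) \<partial>Lb n)"
  unfolding L1norm_def by (intro nn_integral_cong) (simp add: unit_valuedD)

text \<open>
  Integrating \<open>overlap_bound\<close> over \<open>d\<close> turns its right-hand side into the integral of the
  convolution of \<open>F\<close> and \<open>H\<close>; the substitution \<open>x = x\<^sub>0/2 + d/3\<close> costs the factor \<open>3 ^ n\<close>.
\<close>

lemma L1norm_alpha_sum_overlap:
  fixes f g h n \<alpha>
  defines "F \<equiv> alpha_sum n 0 f g" and "H \<equiv> alpha_sum n 0 f h"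
    and "S \<equiv> alpha_sum n \<alpha> (alpha_sum n \<alpha> f g) h"
  assumes \<alpha>: "\<alpha> \<le> 0" and f: "f \<in> Cclass n 0" and g: "g \<in> Cclass n 0" and h: "h \<in> Cclass n 0"
    and x0: "x0 \<in> rspace n"
  shows "L1norm n S * (\<integral>\<^sup>+w. ennreal (sqrt (f w * f (vdiff n x0 w))) \<partial>Lb n)
    \<le> 6 ^ n * (L1norm n F * L1norm n H)" (is "_ * ?K \<le> _")
proof -
  interpret sigma_finite_measure "Lb n" by (rule sigma_finite_Lb)
  note uf = Cclass_unit_valued[OF f] and ug = Cclass_unit_valued[OF g] and uh = Cclass_unit_valued[OF h]
  have F [measurable]: "F \<in> borel_measurable (Lb n)" and H [measurable]: "H \<in> borel_measurable (Lb n)"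
    unfolding F_def H_def by (rule measurable_zero_sum[OF f g] measurable_zero_sum[OF f h])+
  have uS: "unit_valued n S" and uF: "unit_valued n F" and uH: "unit_valued n H"
    unfolding S_def F_def H_def by (intro alpha_sum_unit_valued \<alpha> uf ug uh order_refl)+
  define I where "I x = (\<integral>\<^sup>+u. ennreal (F u) * ennreal (H (vdiff n x u)) \<partial>Lb n)" for x
  have I [measurable]: "I \<in> borel_measurable (Lb n)" unfolding I_def by measurable
  define x where "x d = vadd n (vscale n (1/2) x0) (vscale n (1/3) d)" for d
  have "L1norm n S * ?K = ?K * (\<integral>\<^sup>+d. ennreal (S d) \<partial>Lb n)"
    by (simp add: L1norm_unit_valued[OF uS] mult.commute)
  also have "\<dots> \<le> (\<integral>\<^sup>+d. ?K * ennreal (S d) \<partial>Lb n)" by (rule cmult_nn_integral_le)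
  also have "\<dots> \<le> (\<integral>\<^sup>+d. 2 ^ n * I (x d) \<partial>Lb n)"
    using overlap_bound[OF \<alpha> f g h _ x0]
    by (intro nn_integral_mono) (simp add: I_def x_def S_def F_def H_def mult.commute)
  also have "\<dots> = 2 ^ n * (\<integral>\<^sup>+d. I (x d) \<partial>Lb n)"
    unfolding x_def by (rule nn_integral_cmult) measurable
  also have "(\<integral>\<^sup>+d. I (x d) \<partial>Lb n) = 3 ^ n * (ennreal (\<bar>1/3\<bar> ^ n) * (\<integral>\<^sup>+d. I (x d) \<partial>Lb n))"
    unfolding mult.assoc[symmetric] numeral_power_cancel by simp
  also have "ennreal (\<bar>1/3\<bar> ^ n) * (\<integral>\<^sup>+d. I (x d) \<partial>Lb n) = (\<integral>\<^sup>+x. I x \<partial>Lb n)"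
    unfolding x_def by (rule nn_integral_Lb_affine[OF I vscale_rspace, symmetric]) simp
  also have "\<dots> = L1norm n F * L1norm n H"
    unfolding I_def L1norm_unit_valued[OF uF] L1norm_unit_valued[OF uH]
    by (rule nn_integral_convolution) measurable
  also have "2 ^ n * (3 ^ n * (L1norm n F * L1norm n H)) = 6 ^ n * (L1norm n F * L1norm n H)"
    by (simp add: mult.assoc[symmetric] flip: power_mult_distrib)
  finally show ?thesis .
qed

text \<open>
  The left-hand side is the integral of the convolution of \<open>f\<close> with itself. As \<open>x/2\<close> is the midpoint
  of \<open>w\<close> and \<open>x - w\<close>, log-concavity bounds one of the two square roots of \<open>f(w) f(x - w)\<close> by \<open>f(x/2)\<close>.
\<close>

lemma L1norm_square_le:
  assumes f: "f \<in> Cclass n 0"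
  shows "L1norm n f * L1norm n f \<le>
    (\<integral>\<^sup>+x. ennreal (f (vscale n (1/2) x)) * (\<integral>\<^sup>+w. ennreal (sqrt (f w * f (vdiff n x w))) \<partial>Lb n) \<partial>Lb n)"
proof -
  note uf = Cclass_unit_valued[OF f]
  note [measurable] = Cclass_measurable[OF f]
  have "L1norm n f * L1norm n f = (\<integral>\<^sup>+x. \<integral>\<^sup>+w. ennreal (f w) * ennreal (f (vdiff n x w)) \<partial>Lb n \<partial>Lb n)"
    unfolding L1norm_unit_valued[OF uf]
    by (rule nn_integral_convolution[symmetric]) measurable
  also have "\<dots> \<le> (\<integral>\<^sup>+x. ennreal (f (vscale n (1/2) x)) *
      (\<integral>\<^sup>+w. ennreal (sqrt (f w * f (vdiff n x w))) \<partial>Lb n) \<partial>Lb n)"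
  proof (rule nn_integral_mono)
    fix x assume x: "x \<in> space (Lb n)"
    then have [measurable]: "(\<lambda>w. vdiff n x w) \<in> measurable (Lb n) (Lb n)" by measurable
    have "(\<integral>\<^sup>+w. ennreal (f w) * ennreal (f (vdiff n x w)) \<partial>Lb n)
        \<le> (\<integral>\<^sup>+w. ennreal (f (vscale n (1/2) x)) * ennreal (sqrt (f w * f (vdiff n x w))) \<partial>Lb n)"
    proof (rule nn_integral_mono)
      fix w assume "w \<in> space (Lb n)"
      then have w: "w \<in> rspace n" by simp
      define A B where "A = f w" and "B = f (vdiff n x w)"
      have nn: "0 \<le> A" "0 \<le> B" using unit_valuedD(1)[OF uf] w by (simp_all add: A_def B_def)
      have "vadd n (vscale n (1/2) w) (vscale n (1 - 1/2) (vdiff n x w)) = vscale n (1/2) x"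
        by (rule rspace_eqI[of _ n]) (auto simp: field_simps)
      then have "sqrt A * sqrt B \<le> f (vscale n (1/2) x)"
        using Cclass_log_concave[OF f w vadd_rspace, of "1/2" x "vscale n (- 1) w"] nn
        by (simp add: powr_half_sqrt A_def B_def)
      then have "sqrt (A * B) * sqrt (A * B) \<le> f (vscale n (1/2) x) * sqrt (A * B)"
        using nn by (intro mult_right_mono) (auto simp: real_sqrt_mult)
      then have "A * B \<le> f (vscale n (1/2) x) * sqrt (A * B)" using nn by simp
      then show "ennreal (f w) * ennreal (f (vdiff n x w))
          \<le> ennreal (f (vscale n (1/2) x)) * ennreal (sqrt (f w * f (vdiff n x w)))"
        using nn unit_valuedD(1)[OF uf vscale_rspace]
        by (simp add: ennreal_mult[symmetric] A_def B_def ennreal_leI)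
    qed
    also have "\<dots> = ennreal (f (vscale n (1/2) x)) * (\<integral>\<^sup>+w. ennreal (sqrt (f w * f (vdiff n x w))) \<partial>Lb n)"
      by (rule nn_integral_cmult) measurable
    finally show "(\<integral>\<^sup>+w. ennreal (f w) * ennreal (f (vdiff n x w)) \<partial>Lb n) \<le> \<dots>" .
  qed
  finally show ?thesis .
qed

section \<open>The inequality for sums of three functions\<close>

text \<open>
  Cancelling \<open>\<parallel>f\<parallel>\<close> requires it to be finite and non-zero. If it is infinite, so is the right-hand
  side, because \<open>f \<star>\<^sub>0 g \<ge> f\<close> by \<open>g 0 = 1\<close>.
\<close>

lemma zero_sum_inequality:
  assumes \<alpha>: "\<alpha> \<le> 0" and f: "f \<in> Cclass n 0" and g: "g \<in> Cclass n 0" and h: "h \<in> Cclass n 0"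
  shows "L1norm n f * L1norm n (alpha_sum n \<alpha> (alpha_sum n \<alpha> f g) h)
    \<le> 12 ^ n * (L1norm n (alpha_sum n 0 f g) * L1norm n (alpha_sum n 0 f h))"
proof -
  interpret sigma_finite_measure "Lb n" by (rule sigma_finite_Lb)
  note uf = Cclass_unit_valued[OF f]
  note [measurable] = Cclass_measurable[OF f]
  define A where "A = L1norm n f"
  define s where "s = L1norm n (alpha_sum n \<alpha> (alpha_sum n \<alpha> f g) h)"
  define R where "R = L1norm n (alpha_sum n 0 f g) * L1norm n (alpha_sum n 0 f h)"
  define K where "K x = (\<integral>\<^sup>+w. ennreal (sqrt (f w * f (vdiff n x w))) \<partial>Lb n)" for x
  have K [measurable]: "K \<in> borel_measurable (Lb n)" unfolding K_def by measurable
  have "A * s \<le> 12 ^ n * R"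
  proof (cases "A = 0 \<or> A = top")
    case False
    have A2: "A = ennreal (\<bar>1/2\<bar> ^ n) * (\<integral>\<^sup>+x. ennreal (f (vscale n (1/2) x)) \<partial>Lb n)"
    proof -
      have "A = ennreal (\<bar>1/2\<bar> ^ n) * (\<integral>\<^sup>+x. ennreal (f (vadd n (vzero n) (vscale n (1/2) x))) \<partial>Lb n)"
        unfolding A_def L1norm_unit_valued[OF uf]
        by (rule nn_integral_Lb_affine) auto
      moreover have "vadd n (vzero n) (vscale n (1/2) x) = vscale n (1/2) x" for x
        by (rule rspace_eqI[of _ n]) auto
      ultimately show ?thesis by simp
    qed
    have half: "(\<integral>\<^sup>+x. ennreal (f (vscale n (1/2) x)) \<partial>Lb n) = 2 ^ n * A"
      unfolding A2 mult.assoc[symmetric] numeral_power_cancel by simp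
    \<comment> \<open>The factor \<open>s\<close> goes inside the integral so that the bound on \<open>s * K x\<close> applies for each \<open>x\<close>.\<close>
    have "A * (A * s) = s * (A * A)" by (simp add: ac_simps)
    also have "\<dots> \<le> s * (\<integral>\<^sup>+x. ennreal (f (vscale n (1/2) x)) * K x \<partial>Lb n)"
      unfolding A_def K_def by (intro mult_left_mono L1norm_square_le f) simp
    also have "\<dots> = (\<integral>\<^sup>+x. s * (ennreal (f (vscale n (1/2) x)) * K x) \<partial>Lb n)"
      by (rule nn_integral_cmult[symmetric]) measurable
    also have "\<dots> \<le> (\<integral>\<^sup>+x. ennreal (f (vscale n (1/2) x)) * (6 ^ n * R) \<partial>Lb n)"
    proof (rule nn_integral_mono)
      fix x assume "x \<in> space (Lb n)"
      then have "s * K x \<le> 6 ^ n * R"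
        unfolding s_def K_def R_def by (intro L1norm_alpha_sum_overlap \<alpha> f g h) simp
      then show "s * (ennreal (f (vscale n (1/2) x)) * K x)
          \<le> ennreal (f (vscale n (1/2) x)) * (6 ^ n * R)"
        unfolding mult.left_commute[of s] by (intro mult_left_mono) simp_all
    qed
    also have "\<dots> = 2 ^ n * A * (6 ^ n * R)"
      unfolding half[symmetric] by (rule nn_integral_multc) measurable
    also have "\<dots> = A * ((2 ^ n * 6 ^ n) * R)" by (simp add: ac_simps)
    also have "\<dots> = A * (12 ^ n * R)" by (simp flip: power_mult_distrib)
    finally show ?thesis using False by (simp add: ennreal_mult_le_mult_iff)
  next
    case True
    have le: "A \<le> L1norm n (alpha_sum n 0 f k)" if k: "k \<in> Cclass n 0" for k
      unfolding A_def L1norm_unit_valued[OF uf]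
        L1norm_unit_valued[OF alpha_sum_unit_valued[OF order_refl uf Cclass_unit_valued[OF k]]]
    proof (intro nn_integral_mono ennreal_leI)
      fix x assume "x \<in> space (Lb n)"
      then have x: "x \<in> rspace n" by simp
      show "f x \<le> alpha_sum n 0 f k x"
        using mult_le_alpha_sum[OF order_refl uf Cclass_unit_valued[OF k] x vzero_rspace] CclassD(4)[OF k] x
        by (simp add: vadd_vzero)
    qed
    from True show ?thesis
    proof
      assume "A = top"
      then have "R = top" using le[OF g] le[OF h] by (simp add: R_def top_unique)
      then show ?thesis by (simp add: ennreal_mult_top)
    qed simp
  qed
  then show ?thesis by (simp add: A_def s_def R_def)
qed

theorem theorem1p2:
  shows "\<exists>c::real. 0 < c \<and> c < 26 \<and>
    (\<forall>n\<ge>1. \<forall>\<alpha>\<in>{-\<infinity>..0}. \<forall>\<beta>\<in>{-\<infinity>..0}.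
      \<forall>f\<in>Cclass n 0. \<forall>g\<in>Cclass n 0. \<forall>h\<in>Cclass n 0.
        L1norm n f * L1norm n (alpha_sum n \<alpha> (alpha_sum n \<alpha> f g) h)
          \<le> ennreal (c ^ n) * L1norm n (alpha_sum n \<beta> f g) * L1norm n (alpha_sum n \<beta> f h))"
proof (intro exI[of _ 12] conjI allI impI ballI)
  fix n :: nat and \<alpha> \<beta> :: ereal and f g h :: "(nat \<Rightarrow> real) \<Rightarrow> real"
  assume \<alpha>: "\<alpha> \<in> {-\<infinity>..0}" and \<beta>: "\<beta> \<in> {-\<infinity>..0}"
    and f: "f \<in> Cclass n 0" and g: "g \<in> Cclass n 0" and h: "h \<in> Cclass n 0"
  have mono: "L1norm n (alpha_sum n 0 f k) \<le> L1norm n (alpha_sum n \<beta> f k)" if k: "k \<in> Cclass n 0" for k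
  proof -
    note u = Cclass_unit_valued[OF f] Cclass_unit_valued[OF k]
    have \<beta>0: "\<beta> \<le> 0" using \<beta> by simp
    show ?thesis
      unfolding L1norm_unit_valued[OF alpha_sum_unit_valued[OF order_refl u]]
        L1norm_unit_valued[OF alpha_sum_unit_valued[OF \<beta>0 u]]
      by (intro nn_integral_mono ennreal_leI zero_sum_le_alpha_sum[OF \<beta>0 u]) simp
  qed
  have "L1norm n f * L1norm n (alpha_sum n \<alpha> (alpha_sum n \<alpha> f g) h)
      \<le> 12 ^ n * (L1norm n (alpha_sum n 0 f g) * L1norm n (alpha_sum n 0 f h))"
    using \<alpha> by (intro zero_sum_inequality f g h) simp
  also have "\<dots> \<le> 12 ^ n * (L1norm n (alpha_sum n \<beta> f g) * L1norm n (alpha_sum n \<beta> f h))"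
    by (intro mult_left_mono mult_mono mono g h) simp_all
  also have "\<dots> = ennreal (12 ^ n) * L1norm n (alpha_sum n \<beta> f g) * L1norm n (alpha_sum n \<beta> f h)"
    by (simp add: ennreal_power[symmetric] mult.assoc)
  finally show "L1norm n f * L1norm n (alpha_sum n \<alpha> (alpha_sum n \<alpha> f g) h)
      \<le> ennreal (12 ^ n) * L1norm n (alpha_sum n \<beta> f g) * L1norm n (alpha_sum n \<beta> f h)" .
qed simp_all

end
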